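(* Let $G=(V,E)$ be a graph, let $k\ge 2$, and let $\{S_1,\dots,S_k\}$ be a partition of $V$ into $k$ parts. For $i\in[k]$ let $\mathbf{s}^{(i)}\in\mathbb{R}^n$ be defined by $s^{(i)}_j=-k+1$ if $v_j\in S_i$ and $s^{(i)}_j=1$ otherwise. Then $\mathbf{s}^{(i)}$ is an eigenvector of the adjacency matrix $A$ of $G$ for the eigenvalue $\lambda$ for every $i\in[k]$ if and only if $$d_{v_l}(S_i)-d_{v_l}(S_i,S_j)=\lambda$$ for every $i\in[k]$, every $v_l\in S_i$ and every $j\in[k]$ with $j\neq i$.
   Context: Graphs are finite, simple and undirected with vertex set $V=\{v_1,\dots,v_n\}$; $A$ is the adjacency matrix. For $X\subseteq V$ and $v\in X$, $d_v(X)$ is the number of neighbours of $v$ in $X$; for disjoint $X,Y\subseteq V$ and $v\in X$, $d_v(X,Y)$ is the number of neighbours of $v$ in $Y$. *)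

theory Defs
  imports "Jordan_Normal_Form.Char_Poly" "HOL-Library.Disjoint_Sets"
begin

definition simple_graph :: "'a set \<Rightarrow> 'a set set \<Rightarrow> bool" where
  "simple_graph V E \<longleftrightarrow> finite V \<and> (\<forall>e\<in>E. e \<subseteq> V \<and> card e = 2)"

text \<open>The list \<open>vs\<close> enumerates the vertices; the vertex written \<open>v\<close> with index \<open>j + 1\<close> in
  one-based notation is \<open>vs ! j\<close>, matching the zero-based indices of matrices and vectors.\<close>

definition adjacency_matrix :: "'a list \<Rightarrow> 'a set set \<Rightarrow> real mat" where
  "adjacency_matrix vs E =
     mat (length vs) (length vs) (\<lambda>(i, j). if {vs ! i, vs ! j} \<in> E then 1 else 0)"

definition deg_within :: "'a set set \<Rightarrow> 'a \<Rightarrow> 'a set \<Rightarrow> nat" where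
  "deg_within E v X = card {u \<in> X. {v, u} \<in> E}"

text \<open>Meant for disjoint \<open>X\<close> and \<open>Y\<close> and \<open>v \<in> X\<close>: the set \<open>X\<close> only records where \<open>v\<close> lies and
  does not affect the count.\<close>

definition deg_between :: "'a set set \<Rightarrow> 'a \<Rightarrow> 'a set \<Rightarrow> 'a set \<Rightarrow> nat" where
  "deg_between E v X Y = card {u \<in> Y. {v, u} \<in> E}"

definition part_vec :: "'a list \<Rightarrow> nat \<Rightarrow> 'a set \<Rightarrow> real vec" where
  "part_vec vs k X = vec (length vs) (\<lambda>j. if vs ! j \<in> X then - real k + 1 else 1)"

end

theory Submission
  imports Defs
begin

text \<open>Write \<open>d\<^sub>j\<close> for the number of neighbours of a vertex \<open>v\<close> in \<open>S\<^sub>j\<close> and \<open>D\<close> for its degree.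
  Since the vector of \<open>S\<^sub>i\<close> is the all-ones vector minus \<open>k\<close> times the indicator of \<open>S\<^sub>i\<close>, the
  eigenvector equations at \<open>v \<in> S\<^sub>i\<close> read \<open>D - k d\<^sub>i = (1 - k) \<lambda>\<close> and \<open>D - k d\<^sub>j = \<lambda>\<close> for
  \<open>j \<noteq> i\<close>. Subtracting them gives \<open>d\<^sub>i - d\<^sub>j = \<lambda>\<close>; conversely, summing the latter over \<open>j\<close> gives
  \<open>D = k d\<^sub>i - (k - 1) \<lambda>\<close>, hence the former.\<close>

text \<open>Distinctness makes \<open>(!) vs\<close> a bijection from positions to vertices, so the
  row sum at \<open>a\<close> becomes a sum over vertices. Splitting each entry as 1 minus
  \<open>k\<close> times the indicator of \<open>X\<close> leaves two neighbour counts.\<close>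

lemma adjacency_matrix_mult_part_vec:
  assumes "distinct vs" and "X \<subseteq> set vs" and "a < length vs"
  shows "(adjacency_matrix vs E *\<^sub>v part_vec vs k X) $ a =
    real (deg_within E (vs ! a) (set vs)) - real k * real (deg_within E (vs ! a) X)"
proof -
  let ?e = "\<lambda>u. if {vs ! a, u} \<in> E then 1 else 0 :: real"
  have count: "(\<Sum>u\<in>Y. ?e u) = real (deg_within E (vs ! a) Y)" if "Y \<subseteq> set vs" for Y
    using finite_subset[OF that] by (simp add: deg_within_def sum.If_cases Int_def)
  have bij: "bij_betw ((!) vs) {0..<length vs} (set vs)"
    using assms(1) by (intro bij_betw_nth) auto
  have "(adjacency_matrix vs E *\<^sub>v part_vec vs k X) $ a =
      (\<Sum>b\<in>{0..<length vs}. ?e (vs ! b) * (if vs ! b \<in> X then - real k + 1 else 1))"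
    using assms(3)
    by (auto simp: adjacency_matrix_def part_vec_def scalar_prod_def intro!: sum.cong)
  also have "\<dots> = (\<Sum>u\<in>set vs. ?e u * (if u \<in> X then - real k + 1 else 1))"
    by (rule sum.reindex_bij_betw[OF bij])
  also have "\<dots> = (\<Sum>u\<in>set vs. ?e u - real k * (if u \<in> X then ?e u else 0))"
    by (intro sum.cong) auto
  also have "\<dots> = (\<Sum>u\<in>set vs. ?e u) - real k * (\<Sum>u\<in>set vs \<inter> X. ?e u)"
    by (simp add: sum_subtractf sum_distrib_left sum.inter_restrict)
  also have "set vs \<inter> X = X"
    using assms(2) by auto
  finally show ?thesis
    using assms(2) by (simp add: count)
qed

lemma eigenvector_part_vec_iff:
  assumes "distinct vs" and "X \<subseteq> set vs" and "vs \<noteq> []" and "k \<ge> 2"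
  shows "eigenvector (adjacency_matrix vs E) (part_vec vs k X) lam \<longleftrightarrow>
    (\<forall>v\<in>set vs. real (deg_within E v (set vs)) - real k * real (deg_within E v X) =
      lam * (if v \<in> X then 1 - real k else 1))"
proof -
  \<comment> \<open>An eigenvector must be nonzero. Both possible entries, 1 and 1 -
    \<open>k\<close>, are nonzero for \<open>k\<close> \<ge> 2, so position 0 is a witness whether
    or not its vertex lies in \<open>X\<close>.\<close>
  have "part_vec vs k X $ 0 \<noteq> 0"
    using assms(3,4) by (simp add: part_vec_def)
  then have "part_vec vs k X \<noteq> 0\<^sub>v (length vs)"
    using assms(3) by auto
  then have "eigenvector (adjacency_matrix vs E) (part_vec vs k X) lam \<longleftrightarrow>
      adjacency_matrix vs E *\<^sub>v part_vec vs k X = lam \<cdot>\<^sub>v part_vec vs k X"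
    by (simp add: eigenvector_def adjacency_matrix_def part_vec_def)
  also have "\<dots> \<longleftrightarrow> (\<forall>a<length vs. (adjacency_matrix vs E *\<^sub>v part_vec vs k X) $ a =
      (lam \<cdot>\<^sub>v part_vec vs k X) $ a)"
    by (auto simp: vec_eq_iff adjacency_matrix_def part_vec_def)
  also have "\<dots> \<longleftrightarrow> (\<forall>a<length vs. real (deg_within E (vs ! a) (set vs))
      - real k * real (deg_within E (vs ! a) X) = lam * (if vs ! a \<in> X then 1 - real k else 1))"
    using assms(1,2)
    by (intro all_cong1 imp_cong refl) (simp add: adjacency_matrix_mult_part_vec, simp add: part_vec_def)
  finally show ?thesis
    by (simp add: all_set_conv_all_nth)
qed

lemma deg_within_UN:
  assumes "finite I" and "\<And>i. i \<in> I \<Longrightarrow> finite (S i)" and "disjoint_family_on S I"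
  shows "deg_within E v (\<Union>i\<in>I. S i) = (\<Sum>i\<in>I. deg_within E v (S i))"
proof -
  have "{u \<in> (\<Union>i\<in>I. S i). {v, u} \<in> E} = (\<Union>i\<in>I. {u \<in> S i. {v, u} \<in> E})"
    by auto
  then show ?thesis
    using assms unfolding deg_within_def disjoint_family_on_def
    by (simp add: card_UN_disjoint disjoint_iff)
qed

theorem theorem4p1:
  fixes V :: "'a set" and E :: "'a set set" and vs :: "'a list"
    and k :: nat and S :: "nat \<Rightarrow> 'a set" and lam :: real
  assumes "simple_graph V E"
    and "distinct vs" and "set vs = V"
    and "k \<ge> 2"
    and "partition_on V (S ` {1..k})" and "inj_on S {1..k}"
  shows "(\<forall>i\<in>{1..k}. eigenvector (adjacency_matrix vs E) (part_vec vs k (S i)) lam) \<longleftrightarrow>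
    (\<forall>i\<in>{1..k}. \<forall>v\<in>S i. \<forall>j\<in>{1..k}. j \<noteq> i \<longrightarrow>
       real (deg_within E v (S i)) - real (deg_between E v (S i) (S j)) = lam)"
proof -
  define d where "d v j = real (deg_within E v (S j))" for v j
  define D where "D v = real (deg_within E v V)" for v
  have V: "V = (\<Union>i\<in>{1..k}. S i)"
    using assms(5) by (auto simp: partition_on_def)
  have ne: "S i \<noteq> {}" if "i \<in> {1..k}" for i
    using assms(5) that by (auto simp: partition_on_def)
  have sub: "S i \<subseteq> set vs" if "i \<in> {1..k}" for i
    using that assms(3) V by blast
  \<comment> \<open>\<open>partition_on\<close> only separates distinct sets; injectivity of
    \<open>S\<close> turns distinct indices into distinct parts.\<close>
  have disj: "disjoint_family_on S {1..k}"
    unfolding disjoint_family_on_def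
    using partition_onD2[OF assms(5)] inj_onD[OF assms(6)] by (metis disjointD imageI)
  have fin: "finite (S i)" if "i \<in> {1..k}" for i
    using sub[OF that] finite_subset by blast
  have D: "D v = (\<Sum>j\<in>{1..k}. d v j)" for v
    unfolding D_def d_def V using deg_within_UN[OF _ fin disj] by simp
  \<comment> \<open>Parts of a partition are nonempty, so \<open>S 1\<close> supplies a
    vertex.\<close>
  have "vs \<noteq> []"
    using ne[of 1] sub[of 1] assms(4) by auto
  then have eig: "eigenvector (adjacency_matrix vs E) (part_vec vs k (S i)) lam \<longleftrightarrow>
      (\<forall>v\<in>V. D v - real k * d v i = lam * (if v \<in> S i then 1 - real k else 1))"
    if "i \<in> {1..k}" for i
    using eigenvector_part_vec_iff[OF assms(2) sub[OF that] _ assms(4)] assms(3)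
    by (simp add: D_def d_def)
  have other: "v \<notin> S j" if "i \<in> {1..k}" "j \<in> {1..k}" "v \<in> S i" "j \<noteq> i" for i j v
    using disj that unfolding disjoint_family_on_def by blast
  have between: "real (deg_between E v X (S j)) = d v j" for v X j
    by (simp add: d_def deg_between_def deg_within_def)
  \<comment> \<open>With \<open>v\<close> fixed, the left side collects the equations at
    \<open>v\<close> from all \<open>k\<close> eigenvectors, so the equivalence can be proved one
    vertex at a time.\<close>
  have local_iff: "(\<forall>j\<in>{1..k}. D v - real k * d v j = lam * (if v \<in> S j then 1 - real k else 1))
      \<longleftrightarrow> (\<forall>j\<in>{1..k}. j \<noteq> i \<longrightarrow> d v i - d v j = lam)" (is "?L \<longleftrightarrow> ?R")
    if i: "i \<in> {1..k}" and v: "v \<in> S i" for i v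
  proof
    assume L: ?L
    show ?R
    proof (intro ballI impI)
      fix j assume j: "j \<in> {1..k}" "j \<noteq> i"
      have "D v - real k * d v i = lam * (1 - real k)" "D v - real k * d v j = lam"
        using L i j v other[OF i j(1) v j(2)] by auto
      \<comment> \<open>Subtracting the two equations cancels \<open>D v\<close>, and the right
        sides differ by \<open>lam\<close> - \<open>lam\<close> (1 - \<open>k\<close>) =
        \<open>k\<close> \<open>lam\<close>.\<close>
      then have "real k * (d v i - d v j) = real k * lam"
        by (simp add: algebra_simps)
      then show "d v i - d v j = lam"
        using assms(4) by simp
    qed
  next
    assume R: ?R
    have "D v = d v i + (\<Sum>j\<in>{1..k} - {i}. d v j)"
      unfolding D using i by (intro sum.remove) auto
    also have "(\<Sum>j\<in>{1..k} - {i}. d v j) = (\<Sum>j\<in>{1..k} - {i}. d v i - lam)"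
      using R by (intro sum.cong) (auto simp: algebra_simps)
    \<comment> \<open>The summand is constant, and \<open>k\<close> - 1 parts remain once
      \<open>i\<close> is removed.\<close>
    also have "\<dots> = (real k - 1) * (d v i - lam)"
      using i by simp
    finally have Dv: "D v = real k * d v i - (real k - 1) * lam"
      by (simp add: algebra_simps)
    show ?L
    proof
      fix j assume j: "j \<in> {1..k}"
      show "D v - real k * d v j = lam * (if v \<in> S j then 1 - real k else 1)"
      proof (cases "j = i")
        case True
        then show ?thesis using v by (simp add: Dv algebra_simps)
      next
        case False
        then have dj: "d v j = d v i - lam" using R j by force
        show ?thesis using other[OF i j v False] by (simp add: Dv dj algebra_simps)
      qed
    qed
  qed
  \<comment> \<open>The quantifiers are swapped to put the vertex first; each vertex is then
    assigned to the part containing it, where \<open>local_iff\<close> applies.\<close>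
  have "(\<forall>i\<in>{1..k}. eigenvector (adjacency_matrix vs E) (part_vec vs k (S i)) lam) \<longleftrightarrow>
      (\<forall>v\<in>V. \<forall>j\<in>{1..k}. D v - real k * d v j = lam * (if v \<in> S j then 1 - real k else 1))"
    using eig by blast
  also have "\<dots> \<longleftrightarrow> (\<forall>i\<in>{1..k}. \<forall>v\<in>S i. \<forall>j\<in>{1..k}.
      D v - real k * d v j = lam * (if v \<in> S j then 1 - real k else 1))"
    unfolding V by blast
  also have "\<dots> \<longleftrightarrow> (\<forall>i\<in>{1..k}. \<forall>v\<in>S i. \<forall>j\<in>{1..k}. j \<noteq> i \<longrightarrow> d v i - d v j = lam)"
    using local_iff by blast
  finally show ?thesis
    by (simp add: between d_def)
qed

end
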